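(* Let $X$ be a Banach space with $\dim X\ge 2$ and let $1\le p<\infty$. Then $$C^p_{NJ}(X)=\sup\left\{\frac{2\,C^I_{NJ}\!\left(\frac{1-t}{2},p,X\right)}{1+t^p}: 0\le t\le 1\right\}.$$
   Context: For $x_1,x_2\in X$, isosceles orthogonality $x_1\perp_I x_2$ means $\|x_1+x_2\|=\|x_1-x_2\|$. For $1\le p<\infty$ and $0\le\alpha\le\frac12$, $$C^{I}_{NJ}(\alpha,p,X)=\sup\left\{\frac{\|\alpha x_1+(1-\alpha)x_2\|^{p}+\|(1-\alpha)x_1+\alpha x_2\|^{p}}{\|x_1+x_2\|^{p}}: x_1,x_2\in X,\ (x_1,x_2)\neq(0,0),\ x_1\perp_I x_2\right\}.$$ The $p$-th (generalized) von Neumann–Jordan constant is $$C^p_{NJ}(X)=\sup\left\{\frac{\|x_1+x_2\|^p+\|x_1-x_2\|^p}{2^{p-1}\left(\|x_1\|^p+\|x_2\|^p\right)}: x_1,x_2\in X,\ (x_1,x_2)\ne(0,0)\right\}$$ (here $p$ in $C^p_{NJ}$ is a superscript index, not a power). *)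

theory Defs
  imports "HOL-Analysis.Analysis"
begin

definition isosceles_orthogonal :: "'a::real_normed_vector \<Rightarrow> 'a \<Rightarrow> bool"
  where "isosceles_orthogonal x y \<longleftrightarrow> norm (x + y) = norm (x - y)"

(* The space X is the type argument.  For 1 \<le> p and 0 \<le> \<alpha> \<le> 1/2 all quotients in the two
   sets below lie in [0, 2], and the sets are non-empty as soon as X is non-trivial, so the
   conditionally complete supremum on the reals is the genuine one.  No denominator vanishes:
   x1 + x2 = 0 together with isosceles orthogonality forces x1 = x2 = 0. *)

definition C_NJ_I :: "real \<Rightarrow> real \<Rightarrow> 'a::real_normed_vector itself \<Rightarrow> real"
  where "C_NJ_I \<alpha> p X =
    Sup {(norm (\<alpha> *\<^sub>R x1 + (1 - \<alpha>) *\<^sub>R x2) powr p + norm ((1 - \<alpha>) *\<^sub>R x1 + \<alpha> *\<^sub>R x2) powr p)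
           / norm (x1 + x2) powr p
         | x1 x2 :: 'a. (x1, x2) \<noteq> (0, 0) \<and> isosceles_orthogonal x1 x2}"

definition C_NJ :: "real \<Rightarrow> 'a::real_normed_vector itself \<Rightarrow> real"
  where "C_NJ p X =
    Sup {(norm (x1 + x2) powr p + norm (x1 - x2) powr p)
           / (2 powr (p - 1) * (norm x1 powr p + norm x2 powr p))
         | x1 x2 :: 'a. (x1, x2) \<noteq> (0, 0)}"

end

theory Submission
  imports Defs
begin

text \<open>
  Put \<open>u = x1 + x2\<close> and \<open>v = x1 - x2\<close>.  Isosceles orthogonality of \<open>x1, x2\<close> says that \<open>u\<close> and \<open>v\<close>
  have equal norm, and for \<open>\<alpha> = (1 - t) / 2\<close> the two convex combinations are \<open>(u - t v) / 2\<close> and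
  \<open>(u + t v) / 2\<close>.  So \<open>2 / (1 + t^p)\<close> times the quotient of the isosceles constant is the
  von Neumann--Jordan quotient of \<open>(u, t v)\<close>, whose denominator is \<open>2^(p-1) (1 + t^p) |u|^p\<close>.  Up to
  a swap, every nonzero pair has the form \<open>(u, t v)\<close> with \<open>|u| = |v|\<close> and \<open>0 \<le> t \<le> 1\<close>.
\<close>

definition nj_quotient :: "real \<Rightarrow> 'a::real_normed_vector \<Rightarrow> 'a \<Rightarrow> real"
  where "nj_quotient p x y = (norm (x + y) powr p + norm (x - y) powr p)
           / (2 powr (p - 1) * (norm x powr p + norm y powr p))"

definition nj_iso_quotient :: "real \<Rightarrow> real \<Rightarrow> 'a::real_normed_vector \<Rightarrow> 'a \<Rightarrow> real"
  where "nj_iso_quotient \<alpha> p x y =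
    (norm (\<alpha> *\<^sub>R x + (1 - \<alpha>) *\<^sub>R y) powr p + norm ((1 - \<alpha>) *\<^sub>R x + \<alpha> *\<^sub>R y) powr p)
      / norm (x + y) powr p"

lemma nj_quotient_commute: "nj_quotient p x y = nj_quotient p y x"
  by (simp add: nj_quotient_def norm_minus_commute add.commute)

text \<open>Both norms in the numerator are at most twice the larger of \<open>norm x\<close> and
  \<open>norm y\<close>. The bound is crude; it only serves to make the set behind
  \<open>C_NJ\<close> bounded above.\<close>

lemma nj_quotient_le_4:
  fixes x y :: "'a::real_normed_vector"
  assumes "0 \<le> p"
  shows "nj_quotient p x y \<le> 4"
proof -
  define S where "S = norm x powr p + norm y powr p"
  have S_nonneg: "0 \<le> S"
    by (simp add: S_def)
  define m where "m = max (norm x) (norm y)"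
  have m: "0 \<le> m" "norm (x + y) \<le> 2 * m" "norm (x - y) \<le> 2 * m"
    unfolding m_def using norm_triangle_ineq[of x y] norm_triangle_ineq4[of x y]
    by (auto simp: max_def)
  have "m powr p \<le> S"
    unfolding m_def S_def by (simp add: max_def)
  then have "(2 * m) powr p \<le> 2 powr p * S"
    using m(1) by (simp add: powr_mult)
  then have "norm (x + y) powr p + norm (x - y) powr p \<le> 2 * (2 powr p * S)"
    using powr_mono2[OF assms norm_ge_zero m(2)] powr_mono2[OF assms norm_ge_zero m(3)]
    by linarith
  also have "\<dots> = 4 * (2 powr (p - 1) * S)"
    by (simp add: powr_diff)
  \<comment> \<open>For \<open>S = 0\<close> the quotient is a division by zero, hence 0; otherwise
    the denominator is positive.\<close>
  finally show ?thesis
    unfolding nj_quotient_def S_def[symmetric]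
    by (cases "S = 0") (simp_all add: pos_divide_le_eq S_nonneg order_less_le)
qed

lemma nj_iso_quotient_eq:
  fixes x y :: "'a::real_normed_vector"
  assumes "0 \<le> t" and "isosceles_orthogonal x y"
  shows "2 * nj_iso_quotient ((1 - t) / 2) p x y / (1 + t powr p)
           = nj_quotient p (x + y) (t *\<^sub>R (x - y))"
proof -
  define u v where "u = x + y" and "v = x - y"
  have uv: "norm u = norm v"
    using assms(2) by (simp add: isosceles_orthogonal_def u_def v_def)
  have "((1 - t) / 2) *\<^sub>R x + (1 - (1 - t) / 2) *\<^sub>R y = (1 / 2) *\<^sub>R (u - t *\<^sub>R v)"
    and "(1 - (1 - t) / 2) *\<^sub>R x + ((1 - t) / 2) *\<^sub>R y = (1 / 2) *\<^sub>R (u + t *\<^sub>R v)"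
    by (simp_all add: u_def v_def algebra_simps diff_divide_distrib add_divide_distrib
        flip: scaleR_add_left)
  then have "nj_iso_quotient ((1 - t) / 2) p x y
      = (norm (u + t *\<^sub>R v) powr p + norm (u - t *\<^sub>R v) powr p) / (2 powr p * norm u powr p)"
    unfolding nj_iso_quotient_def u_def[symmetric]
    by (simp add: powr_divide add_divide_distrib)
  moreover have "norm u powr p + norm (t *\<^sub>R v) powr p = norm u powr p * (1 + t powr p)"
    using assms(1) uv by (simp add: powr_mult algebra_simps)
  \<comment> \<open>The factor 1/2 in the convex combinations puts \<open>2 powr p\<close> into the
    denominator; the 2 on the left lowers it to \<open>2 powr (p - 1)\<close>.\<close>
  ultimately show ?thesis
    unfolding nj_quotient_def u_def[symmetric] v_def[symmetric]
    by (simp add: powr_diff mult.assoc)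
qed

text \<open>Rescale \<open>y\<close> to a vector \<open>v\<close> with the norm of \<open>x\<close>;
  the half sum and half difference of \<open>x\<close> and \<open>v\<close> are then isosceles
  orthogonal, and \<open>t\<close> undoes the scaling.\<close>

lemma exists_isosceles_orthogonal_representation:
  fixes x y :: "'a::real_normed_vector"
  assumes "norm y \<le> norm x" and "x \<noteq> 0"
  obtains t a b where "0 \<le> t" "t \<le> 1" "isosceles_orthogonal a b" "(a, b) \<noteq> (0, 0)"
    "x = a + b" "y = t *\<^sub>R (a - b)"
proof -
  define t where "t = norm y / norm x"
  \<comment> \<open>For \<open>y = 0\<close> the scalar \<open>t\<close> is 0, so any
    \<open>v\<close> with the norm of \<open>x\<close> works; \<open>x\<close> itself is
    taken.\<close>
  define v where "v = (if y = 0 then x else (1 / t) *\<^sub>R y)"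
  define a b where "a = (1 / 2) *\<^sub>R (x + v)" and "b = (1 / 2) *\<^sub>R (x - v)"
  have sum: "a + b = x" and diff: "a - b = v"
    unfolding a_def b_def by (simp_all add: algebra_simps flip: scaleR_add_left)
  show thesis
  proof
    show "0 \<le> t" "t \<le> 1"
      using assms by (auto simp: t_def divide_simps)
    show "isosceles_orthogonal a b"
      using assms(2) by (auto simp: isosceles_orthogonal_def sum diff v_def t_def)
    show "(a, b) \<noteq> (0, 0)"
      using assms(2) sum by auto
    show "x = a + b"
      by (simp add: sum)
    show "y = t *\<^sub>R (a - b)"
      using assms(2) by (auto simp: diff v_def t_def)
  qed
qed

lemma C_NJ_I_eq:
  "C_NJ_I \<alpha> p TYPE('a::real_normed_vector) =
    Sup {nj_iso_quotient \<alpha> p x y | x y :: 'a. (x, y) \<noteq> (0, 0) \<and> isosceles_orthogonal x y}"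
  by (simp add: C_NJ_I_def nj_iso_quotient_def)

lemma nj_quotient_le_C_NJ:
  fixes x y :: "'a::real_normed_vector"
  assumes "0 \<le> p" and "(x, y) \<noteq> (0, 0)"
  shows "nj_quotient p x y \<le> C_NJ p TYPE('a)"
  unfolding C_NJ_def nj_quotient_def[symmetric]
proof (rule cSup_upper)
  show "bdd_above {nj_quotient p x1 x2 |x1 x2 :: 'a. (x1, x2) \<noteq> (0, 0)}"
    by (rule bdd_aboveI[of _ 4]) (use nj_quotient_le_4[OF assms(1)] in blast)
qed (use assms(2) in blast)

text \<open>Solve \<open>nj_iso_quotient_eq\<close> for the isosceles quotient. The bound is uniform
  in \<open>x\<close> and \<open>y\<close>, so it shows that the set behind \<open>C_NJ_I\<close> is
  bounded above and also estimates its supremum.\<close>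

lemma nj_iso_quotient_le_C_NJ:
  fixes x y :: "'a::real_normed_vector"
  assumes "0 \<le> p" "0 \<le> t" "isosceles_orthogonal x y" "(x, y) \<noteq> (0, 0)"
  shows "nj_iso_quotient ((1 - t) / 2) p x y \<le> C_NJ p TYPE('a) * (1 + t powr p) / 2"
proof -
  \<comment> \<open>This makes \<open>(x + y, t *\<^sub>R (x - y))\<close> an admissible pair for
    \<open>C_NJ\<close>, even when \<open>t = 0\<close>.\<close>
  have "x + y \<noteq> 0"
  proof
    assume "x + y = 0"
    then have "norm (x - y) = 0" "x + y = 0"
      using assms(3) by (auto simp: isosceles_orthogonal_def)
    then show False
      using assms(4) by (simp flip: scaleR_2)
  qed
  then have "2 * nj_iso_quotient ((1 - t) / 2) p x y / (1 + t powr p) \<le> C_NJ p TYPE('a)"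
    using nj_quotient_le_C_NJ[OF assms(1), of "x + y" "t *\<^sub>R (x - y)"]
    by (simp add: nj_iso_quotient_eq[OF assms(2,3)])
  moreover have "0 < 1 + t powr p"
    using powr_ge_zero[of t p] by linarith
  ultimately show ?thesis
    by (simp add: field_simps)
qed

lemma nj_iso_quotient_le_C_NJ_I:
  fixes x y :: "'a::real_normed_vector"
  assumes "0 \<le> p" "0 \<le> t" "isosceles_orthogonal x y" "(x, y) \<noteq> (0, 0)"
  shows "nj_iso_quotient ((1 - t) / 2) p x y \<le> C_NJ_I ((1 - t) / 2) p TYPE('a)"
  unfolding C_NJ_I_eq
proof (rule cSup_upper)
  show "bdd_above {nj_iso_quotient ((1 - t) / 2) p x y | x y :: 'a.
      (x, y) \<noteq> (0, 0) \<and> isosceles_orthogonal x y}"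
    by (rule bdd_aboveI[of _ "C_NJ p TYPE('a) * (1 + t powr p) / 2"])
      (use nj_iso_quotient_le_C_NJ[OF assms(1,2)] in blast)
qed (use assms(3,4) in blast)

lemma C_NJ_I_le_C_NJ:
  assumes "0 \<le> p" "0 \<le> t" and "\<exists>z :: 'a::real_normed_vector. z \<noteq> 0"
  shows "2 * C_NJ_I ((1 - t) / 2) p TYPE('a) / (1 + t powr p) \<le> C_NJ p TYPE('a)"
proof -
  obtain z :: 'a where "z \<noteq> 0"
    using assms(3) by blast
  \<comment> \<open>This pair shows that the set behind \<open>C_NJ_I\<close> is non-empty, as
    \<open>cSup_least\<close> demands.\<close>
  then have "(z, 0) \<noteq> (0, 0) \<and> isosceles_orthogonal z 0"
    by (simp add: isosceles_orthogonal_def)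
  then have "C_NJ_I ((1 - t) / 2) p TYPE('a) \<le> C_NJ p TYPE('a) * (1 + t powr p) / 2"
    unfolding C_NJ_I_eq
    by (intro cSup_least) (use nj_iso_quotient_le_C_NJ[OF assms(1,2)] in blast)+
  moreover have "0 < 1 + t powr p"
    using powr_ge_zero[of t p] by linarith
  ultimately show ?thesis
    by (simp add: field_simps)
qed

text \<open>The suitable \<open>t\<close> depends on the pair: it comes from representing the pair,
  larger norm first, through isosceles orthogonal vectors.\<close>

lemma nj_quotient_le_C_NJ_I:
  fixes x y :: "'a::real_normed_vector"
  assumes "0 \<le> p" and "(x, y) \<noteq> (0, 0)"
  obtains t where "0 \<le> t" "t \<le> 1"
    "nj_quotient p x y \<le> 2 * C_NJ_I ((1 - t) / 2) p TYPE('a) / (1 + t powr p)"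
proof -
  \<comment> \<open>By symmetry of the quotient the vector of larger norm may come first; it is
    nonzero because the pair is.\<close>
  obtain u w :: 'a where uw: "norm w \<le> norm u" "u \<noteq> 0" "nj_quotient p x y = nj_quotient p u w"
  proof (cases "norm y \<le> norm x")
    case True
    then show ?thesis
      using that[of y x] assms(2) by fastforce
  next
    case False
    then show ?thesis
      using that[of x y] nj_quotient_commute[of p x y] by fastforce
  qed
  obtain t a b where t: "0 \<le> t" "t \<le> 1" and ab: "isosceles_orthogonal a b" "(a, b) \<noteq> (0, 0)"
    and "u = a + b" "w = t *\<^sub>R (a - b)"
    by (rule exists_isosceles_orthogonal_representation[OF uw(1,2)])
  then have "nj_quotient p x y = 2 * nj_iso_quotient ((1 - t) / 2) p a b / (1 + t powr p)"
    using uw(3) by (simp add: nj_iso_quotient_eq)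
  also have "\<dots> \<le> 2 * C_NJ_I ((1 - t) / 2) p TYPE('a) / (1 + t powr p)"
    using nj_iso_quotient_le_C_NJ_I[OF assms(1) t(1) ab]
    by (intro divide_right_mono mult_left_mono) auto
  finally show thesis
    using that t by blast
qed

theorem theorem2:
  fixes p :: real
  assumes "\<exists>B :: 'a::banach set. independent B \<and> card B = 2"
    and "1 \<le> p"
  shows "C_NJ p TYPE('a) =
    Sup {2 * C_NJ_I ((1 - t) / 2) p TYPE('a) / (1 + t powr p) | t. 0 \<le> t \<and> t \<le> 1}"
    (is "_ = Sup ?T")
proof (rule antisym)
  have p: "0 \<le> p"
    using assms(2) by simp
  obtain B :: "'a set" where B: "independent B" "card B = 2"
    using assms(1) by blast
  \<comment> \<open>Elements of an independent set are nonzero, so the dimension hypothesis yields a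
    nonzero vector.\<close>
  then obtain z where "z \<in> B"
    by fastforce
  with B(1) have z: "z \<noteq> 0"
    using dependent_zero by blast
  have le: "s \<le> C_NJ p TYPE('a)" if "s \<in> ?T" for s
    using that C_NJ_I_le_C_NJ[OF p] z by blast
  then have bdd: "bdd_above ?T"
    by (rule bdd_aboveI)
  show "Sup ?T \<le> C_NJ p TYPE('a)"
    by (rule cSup_least) (use le in \<open>force+\<close>)
  show "C_NJ p TYPE('a) \<le> Sup ?T"
    unfolding C_NJ_def nj_quotient_def[symmetric]
  proof (rule cSup_least)
    show "{nj_quotient p x1 x2 |x1 x2 :: 'a. (x1, x2) \<noteq> (0, 0)} \<noteq> {}"
      using z by blast
  next
    fix s
    assume "s \<in> {nj_quotient p x1 x2 |x1 x2 :: 'a. (x1, x2) \<noteq> (0, 0)}"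
    then obtain x y :: 'a where s: "s = nj_quotient p x y" and "(x, y) \<noteq> (0, 0)"
      by blast
    then obtain t where "0 \<le> t" "t \<le> 1"
      and "s \<le> 2 * C_NJ_I ((1 - t) / 2) p TYPE('a) / (1 + t powr p)"
      using nj_quotient_le_C_NJ_I[OF p] by metis
    then show "s \<le> Sup ?T"
      by (intro cSup_upper2[OF _ _ bdd]) blast+
  qed
qed

end
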